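(* Let $\mathcal{C}$ be the class of $\Delta$-matroids that are $\mathrm{inv}$-representable over $\mathrm{GF}(4)$. Then $\mathcal{C}$ is closed under twist and loop complementation: if $M=(V,D)\in\mathcal{C}$ and $X\subseteq V$, then both $M*X$ and $M+X$ belong to $\mathcal{C}$ (in particular they are $\Delta$-matroids).
   Context: A set system is a pair $M=(V,D)$ with $V$ a finite set and $D$ a family of subsets of $V$; write $Y\in M$ for $Y\in D$; $M$ is proper if $D\neq\emptyset$. Twist: $M*X=(V,\{Y\triangle X: Y\in D\})$ ($\triangle$ = symmetric difference). Loop complementation: $M+X=(V,D')$ where $Y\in D'$ iff the number of $Z\in D$ with $Y\setminus X\subseteq Z\subseteq Y$ is odd. A proper set system $M$ is a $\Delta$-matroid if for all $X,Y\in M$ and all $x\in X\triangle Y$ there is $y\in X\triangle Y$ (possibly $y=x$) with $X\triangle\{x,y\}\in M$. For a $V\times V$-matrix $A$ over a field, $\mathcal{M}_A=(V,\{X\subseteq V: A[X]\text{ nonsingular}\})$, where $A[X]$ is the principal submatrix on $X$ and $A[\emptyset]$ counts as nonsingular. $\mathrm{inv}$ is the nontrivial automorphism $x\mapsto x^2$ of $\mathrm{GF}(4)$, applied entrywise; a $V\times V$-matrix $A$ over $\mathrm{GF}(4)$ is $\mathrm{inv}$-symmetric if $\mathrm{inv}(-A^T)=A$. A $\Delta$-matroid $M$ over $V$ is $\mathrm{inv}$-representable over $\mathrm{GF}(4)$ if $M=\mathcal{M}_A*X$ for some $\mathrm{inv}$-symmetric $V\times V$-matrix $A$ over $\mathrm{GF}(4)$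 and some $X\subseteq V$. *)

theory Defs
  imports "HOL-Library.Z2" "HOL-Combinatorics.Permutations" "HOL-Library.Cardinality"
begin

section \<open>The field with four elements\<close>

text \<open>\<open>GF4 a b\<close> stands for \<open>a + b\<omega>\<close> with \<open>a, b\<close> in the two-element field and \<open>\<omega>\<^sup>2 = \<omega> + 1\<close>.\<close>

datatype gf4 = GF4 bit bit

lemma gf4_cases:
  obtains "x = GF4 0 0" | "x = GF4 1 0" | "x = GF4 0 1" | "x = GF4 1 1"
  by (metis bit.exhaust gf4.exhaust)

instantiation gf4 :: field
begin

definition zero_gf4 :: gf4 where "0 = GF4 0 0"
definition one_gf4 :: gf4 where "1 = GF4 1 0"

fun plus_gf4 :: "gf4 \<Rightarrow> gf4 \<Rightarrow> gf4" where
  "GF4 a b + GF4 c d = GF4 (a + c) (b + d)"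

fun uminus_gf4 :: "gf4 \<Rightarrow> gf4" where
  "- GF4 a b = GF4 (- a) (- b)"

fun minus_gf4 :: "gf4 \<Rightarrow> gf4 \<Rightarrow> gf4" where
  "GF4 a b - GF4 c d = GF4 (a - c) (b - d)"

fun times_gf4 :: "gf4 \<Rightarrow> gf4 \<Rightarrow> gf4" where
  "GF4 a b * GF4 c d = GF4 (a * c + b * d) (a * d + b * c + b * d)"

text \<open>Since \<open>x\<^sup>3 = 1\<close> for \<open>x \<noteq> 0\<close>, the inverse of \<open>x\<close> is \<open>x\<^sup>2\<close>.\<close>

definition inverse_gf4 :: "gf4 \<Rightarrow> gf4" where "inverse x = x * (x :: gf4)"
definition divide_gf4 :: "gf4 \<Rightarrow> gf4 \<Rightarrow> gf4" where "x div y = x * inverse (y :: gf4)"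

instance
proof
  fix a b c :: gf4
  show "a + b + c = a + (b + c)" by (cases a rule: gf4_cases; cases b rule: gf4_cases; cases c rule: gf4_cases) simp_all
  show "a + b = b + a" by (cases a rule: gf4_cases; cases b rule: gf4_cases) simp_all
  show "0 + a = a" by (cases a) (simp add: zero_gf4_def)
  show "- a + a = 0" by (cases a) (simp add: zero_gf4_def)
  show "a - b = a + - b" by (cases a rule: gf4_cases; cases b rule: gf4_cases) simp_all
  show "a * b * c = a * (b * c)" by (cases a rule: gf4_cases; cases b rule: gf4_cases; cases c rule: gf4_cases) simp_all
  show "a * b = b * a" by (cases a rule: gf4_cases; cases b rule: gf4_cases) simp_all
  show "1 * a = a" by (cases a) (simp add: one_gf4_def)
  show "(a + b) * c = a * c + b * c" by (cases a rule: gf4_cases; cases b rule: gf4_cases; cases c rule: gf4_cases) simp_all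
  show "(0 :: gf4) \<noteq> 1" by (simp add: zero_gf4_def one_gf4_def)
  show "a div b = a * inverse b" by (rule divide_gf4_def)
  show "inverse (0 :: gf4) = 0" by (simp add: inverse_gf4_def zero_gf4_def)
  show "inverse a * a = 1" if "a \<noteq> 0"
    using that by (cases a rule: gf4_cases) (simp_all add: inverse_gf4_def zero_gf4_def one_gf4_def)
qed

end

lemma UNIV_gf4: "(UNIV :: gf4 set) = {GF4 0 0, GF4 1 0, GF4 0 1, GF4 1 1}"
  using gf4_cases by blast

lemma card_gf4: "CARD(gf4) = 4"
  by (simp add: UNIV_gf4)

definition gf4_inv :: "gf4 \<Rightarrow> gf4" where
  "gf4_inv x = x ^ 2"


section \<open>Set systems\<close>

type_synonym 'a set_system = "'a set \<times> 'a set set"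

definition set_system :: "'a set_system \<Rightarrow> bool" where
  "set_system M \<longleftrightarrow> finite (fst M) \<and> snd M \<subseteq> Pow (fst M)"

definition proper :: "'a set_system \<Rightarrow> bool" where
  "proper M \<longleftrightarrow> snd M \<noteq> {}"

definition twist :: "'a set_system \<Rightarrow> 'a set \<Rightarrow> 'a set_system" where
  "twist M X = (fst M, {sym_diff Y X | Y. Y \<in> snd M})"

definition loop_complement :: "'a set_system \<Rightarrow> 'a set \<Rightarrow> 'a set_system" where
  "loop_complement M X =
    (fst M, {Y. Y \<subseteq> fst M \<and> odd (card {Z \<in> snd M. Y - X \<subseteq> Z \<and> Z \<subseteq> Y})})"

definition delta_matroid :: "'a set_system \<Rightarrow> bool" where
  "delta_matroid M \<longleftrightarrow> set_system M \<and> proper M \<and>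
    (\<forall>X \<in> snd M. \<forall>Y \<in> snd M. \<forall>x \<in> sym_diff X Y. \<exists>y \<in> sym_diff X Y.
      sym_diff X {x, y} \<in> snd M)"


section \<open>Representations\<close>

text \<open>
  A \<open>V \<times> V\<close>-matrix is a function of two arguments of which only the values on \<open>V\<close> matter.
  \<open>det_on X A\<close> is the determinant of the principal submatrix \<open>A[X]\<close>, given by the Leibniz
  formula; it is \<open>1\<close> for \<open>X = {}\<close>.
\<close>

definition det_on :: "'a set \<Rightarrow> ('a \<Rightarrow> 'a \<Rightarrow> 'f :: comm_ring_1) \<Rightarrow> 'f" where
  "det_on X A = (\<Sum>p | p permutes X. of_int (sign p) * (\<Prod>i\<in>X. A i (p i)))"

definition matrix_set_system :: "'a set \<Rightarrow> ('a \<Rightarrow> 'a \<Rightarrow> 'f :: field) \<Rightarrow> 'a set_system" where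
  "matrix_set_system V A = (V, {X. X \<subseteq> V \<and> det_on X A \<noteq> 0})"

definition inv_symmetric :: "'a set \<Rightarrow> ('a \<Rightarrow> 'a \<Rightarrow> gf4) \<Rightarrow> bool" where
  "inv_symmetric V A \<longleftrightarrow> (\<forall>i\<in>V. \<forall>j\<in>V. gf4_inv (- A j i) = A i j)"

definition inv_representable :: "'a set_system \<Rightarrow> bool" where
  "inv_representable M \<longleftrightarrow>
    (\<exists>A X. inv_symmetric (fst M) A \<and> X \<subseteq> fst M \<and> M = twist (matrix_set_system (fst M) A) X)"

definition inv_representable_delta_matroids :: "'a set_system set" where
  "inv_representable_delta_matroids = {M. delta_matroid M \<and> inv_representable M}"

end

theory Submission
  imports Defs
begin

text \<open>
  Over \<open>GF(4)\<close> an \<open>inv\<close>-symmetric matrix \<open>A\<close> is Hermitian, so its principal minors lie in \<open>GF(2)\<close> and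
  the feasible sets of \<open>A\<close> form a family with indicator function \<open>Y \<mapsto> det A[Y]\<close>. Hence loop
  complementation at \<open>u\<close> adds \<open>1\<close> to the diagonal entry at \<open>u\<close>, and, if that entry is nonzero, twisting
  at \<open>u\<close> is the principal pivot at \<open>u\<close>; both operations preserve the symmetry. A twist at \<open>u\<close> that is
  not a pivot is handled by the relation \<open>(*u +u)\<^sup>3 = 1\<close>. By the same relation a pivot on a
  pair \<open>{u,v}\<close> with zero diagonal decomposes into operations at single elements. So \<open>\<M>\<^sub>A * X\<close> is again
  of the form \<open>\<M>\<^sub>B\<close> for every feasible \<open>X\<close>, which gives the exchange axiom: it then only
  has to be checked at \<open>X = \<emptyset>\<close>, where it says that a nonsingular matrix has no zero row.
\<close>

section \<open>Determinants of principal submatrices\<close>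

lemma det_on_cong:
  assumes "\<And>i j. i \<in> X \<Longrightarrow> j \<in> X \<Longrightarrow> A i j = B i j"
  shows "det_on X A = det_on X B"
  unfolding det_on_def
  by (intro sum.cong refl arg_cong2[where f = "(*)"] prod.cong)
    (use assms permutes_in_image in \<open>fastforce\<close>)

lemma det_on_transpose:
  assumes "finite X"
  shows "det_on X (\<lambda>i j. A j i) = det_on X A"
proof -
  have "det_on X (\<lambda>i j. A j i) =
      (\<Sum>p | p permutes X. of_int (sign (inv p)) * (\<Prod>i\<in>X. A (inv p i) i))"
    unfolding det_on_def by (rule sum_permutations_inverse)
  also have "\<dots> = det_on X A"
    unfolding det_on_def
  proof (intro sum.cong refl)
    fix p assume "p \<in> {p. p permutes X}"
    then have p: "p permutes X" by simp
    have "(\<Prod>i\<in>X. A (inv p i) i) = (\<Prod>i\<in>X. A (inv p (p i)) (p i))"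
      using prod.permute[OF p, of "\<lambda>i. A (inv p i) i"] by (simp add: o_def)
    also have "\<dots> = (\<Prod>i\<in>X. A i (p i))"
      using permutes_inverses(2)[OF p] by simp
    finally have "(\<Prod>i\<in>X. A (inv p i) i) = (\<Prod>i\<in>X. A i (p i))" .
    moreover have "sign (inv p) = sign p"
      using p assms permutation_permutes by (blast intro: sign_inverse)
    ultimately show "of_int (sign (inv p)) * (\<Prod>i\<in>X. A (inv p i) i) =
        of_int (sign p) * (\<Prod>i\<in>X. A i (p i))"
      by simp
  qed
  finally show ?thesis .
qed

section \<open>Vanishing determinants and row operations\<close>

lemma det_on_zero_row:
  assumes "finite X" "u \<in> X" "\<And>j. j \<in> X \<Longrightarrow> A u j = 0"
  shows "det_on X A = 0"
  unfolding det_on_def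
proof (rule sum.neutral, safe)
  fix p assume p: "p permutes X"
  have "A u (p u) = 0" using assms permutes_in_image[OF p] by simp
  then have "(\<Prod>i\<in>X. A i (p i)) = 0"
    using assms(1,2) by (auto simp: prod.remove[of X u])
  then show "of_int (sign p) * (\<Prod>i\<in>X. A i (p i)) = 0" by simp
qed

text \<open>Composition with the transposition of \<open>u\<close> and \<open>v\<close> pairs even
  permutations with odd ones and keeps the product, so the terms cancel. Concluding from
  \<open>det = - det\<close> would fail in characteristic 2.\<close>

lemma det_on_identical_rows:
  assumes "finite X" "u \<in> X" "v \<in> X" "u \<noteq> v" "\<And>j. j \<in> X \<Longrightarrow> A u j = A v j"
  shows "det_on X A = 0"
proof -
  let ?t = "transpose u v"
  let ?P = "\<lambda>p. \<Prod>i\<in>X. A i (p i)"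
  let ?E = "{p. p permutes X \<and> evenperm p}" and ?O = "{p. p permutes X \<and> \<not> evenperm p}"
  have t: "?t permutes X" using assms by (simp add: permutes_swap_id)
  have even_swap: "evenperm (p \<circ> ?t) \<longleftrightarrow> \<not> evenperm p" if "p permutes X" for p
    using that assms permutation_permutes
    by (subst evenperm_comp) (auto simp: evenperm_swap permutation_swap_id)
  have invol: "(p \<circ> ?t) \<circ> ?t = p" for p by (simp add: o_assoc[symmetric])
  have bij: "bij_betw (\<lambda>p. p \<circ> ?t) ?E ?O"
    by (rule bij_betw_byWitness[where f' = "\<lambda>p. p \<circ> ?t"])
      (auto simp: invol even_swap permutes_compose[OF t])
  have P_swap: "?P (p \<circ> ?t) = ?P p" if "p permutes X" for p
  proof -
    have "?P (p \<circ> ?t) = (\<Prod>i\<in>X. A (?t i) ((p \<circ> ?t) (?t i)))"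
      using prod.permute[OF t, of "\<lambda>i. A i ((p \<circ> ?t) i)"] by (simp add: o_def)
    also have "\<dots> = ?P p"
    proof (rule prod.cong[OF refl])
      fix i assume "i \<in> X"
      then have "p i \<in> X" using permutes_in_image[OF that] by simp
      then show "A (?t i) ((p \<circ> ?t) (?t i)) = A i (p i)"
        using assms(5) by (auto simp: transpose_def)
    qed
    finally show ?thesis .
  qed
  have fin: "finite {p. p permutes X}" using assms finite_permutations by blast
  have "det_on X A = (\<Sum>p\<in>?E \<union> ?O. of_int (sign p) * ?P p)"
    unfolding det_on_def by (rule sum.cong) auto
  also have "\<dots> = (\<Sum>p\<in>?E. of_int (sign p) * ?P p) + (\<Sum>p\<in>?O. of_int (sign p) * ?P p)"
    by (rule sum.union_disjoint) (auto intro: finite_subset[OF _ fin])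
  also have "\<dots> = (\<Sum>p\<in>?E. ?P p) - (\<Sum>p\<in>?O. ?P p)"
    by (simp add: sign_def sum_negf)
  also have "(\<Sum>p\<in>?O. ?P p) = (\<Sum>p\<in>?E. ?P (p \<circ> ?t))"
    by (rule sum.reindex_bij_betw[OF bij, symmetric])
  also have "\<dots> = (\<Sum>p\<in>?E. ?P p)"
    by (rule sum.cong) (use P_swap in auto)
  finally show ?thesis by simp
qed

lemma det_on_row_linear:
  assumes "finite X" "v \<in> X"
  shows "det_on X (A(v := \<lambda>j. a j + c * b j)) = det_on X (A(v := a)) + c * det_on X (A(v := b))"
  unfolding det_on_def sum_distrib_left sum.distrib[symmetric]
proof (rule sum.cong[OF refl])
  fix p
  have "(\<Prod>i\<in>X - {v}. (A(v := f)) i (p i)) = (\<Prod>i\<in>X - {v}. A i (p i))" for f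
    by (rule prod.cong) auto
  then show "of_int (sign p) * (\<Prod>i\<in>X. (A(v := \<lambda>j. a j + c * b j)) i (p i)) =
      of_int (sign p) * (\<Prod>i\<in>X. (A(v := a)) i (p i)) +
      c * (of_int (sign p) * (\<Prod>i\<in>X. (A(v := b)) i (p i)))"
    using assms by (simp add: prod.remove[of X v] algebra_simps)
qed

lemma det_on_add_row_multiple:
  assumes "finite X" "u \<in> X" "v \<in> X" "u \<noteq> v"
  shows "det_on X (A(v := \<lambda>j. A v j + c * A u j)) = det_on X A"
proof -
  have "det_on X (A(v := A u)) = 0"
    by (rule det_on_identical_rows[of X u v]) (use assms in auto)
  then show ?thesis using assms by (simp add: det_on_row_linear)
qed

lemma det_on_add_row_multiples:
  assumes "finite X" "u \<in> X" "Y \<subseteq> X - {u}"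
  shows "det_on X (\<lambda>i j. if i \<in> Y then A i j + c i * A u j else A i j) = det_on X A"
proof -
  have "finite Y" using assms finite_subset by blast
  then show ?thesis using assms(3)
  proof (induction Y)
    case empty
    show ?case by simp
  next
    case (insert v Y)
    let ?B = "\<lambda>i j. if i \<in> Y then A i j + c i * A u j else A i j"
    have "u \<notin> Y" "v \<noteq> u" "v \<in> X" using insert by auto
    \<comment> \<open>Row \<open>u\<close> lies outside \<open>Y\<close>, so it is still the
      original row when row \<open>v\<close> is treated.\<close>
    then have "(\<lambda>i j. if i \<in> insert v Y then A i j + c i * A u j else A i j) =
        ?B(v := \<lambda>j. ?B v j + c v * ?B u j)"
      using insert by (intro ext) auto
    then have "det_on X (\<lambda>i j. if i \<in> insert v Y then A i j + c i * A u j else A i j) = det_on X ?B"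
      using det_on_add_row_multiple[of X u v ?B "c v"] \<open>v \<noteq> u\<close> \<open>v \<in> X\<close> assms by metis
    then show ?case using insert by auto
  qed
qed

section \<open>Expansion along a unit column and Schur complements\<close>

lemma permutes_fixing_iff:
  assumes "u \<notin> Y"
  shows "p permutes insert u Y \<and> p u = u \<longleftrightarrow> p permutes Y"
  using assms by (metis insertE permutes_not_in permutes_subset permutes_superset
      subset_insertI Diff_iff insertI1)

text \<open>A permutation that moves \<open>u\<close> sends some row of \<open>Y\<close> to column
  \<open>u\<close> and meets a zero there; those that fix \<open>u\<close> are the permutations of
  \<open>Y\<close>.\<close>

lemma det_on_unit_column:
  assumes "finite Y" "u \<notin> Y" "A u u = 1" "\<And>i. i \<in> Y \<Longrightarrow> A i u = 0"
  shows "det_on (insert u Y) A = det_on Y A"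
proof -
  have "det_on (insert u Y) A =
      (\<Sum>p | p permutes Y. of_int (sign p) * (\<Prod>i\<in>insert u Y. A i (p i)))"
    unfolding det_on_def
  proof (rule sum.mono_neutral_right)
    show "finite {p. p permutes insert u Y}" using assms(1) by (simp add: finite_permutations)
    show "{p. p permutes Y} \<subseteq> {p. p permutes insert u Y}"
      using permutes_fixing_iff[OF assms(2)] by blast
    show "\<forall>p\<in>{p. p permutes insert u Y} - {p. p permutes Y}.
        of_int (sign p) * (\<Prod>i\<in>insert u Y. A i (p i)) = 0"
    proof
      fix p assume "p \<in> {p. p permutes insert u Y} - {p. p permutes Y}"
      then have p: "p permutes insert u Y" "p u \<noteq> u"
        using permutes_fixing_iff[OF assms(2)] by blast+
      then obtain i where i: "i \<in> insert u Y" "p i = u"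
        using permutes_image[OF p(1)] by (metis imageE insertI1)
      then have "A i (p i) = 0" using p assms(4) by auto
      then have "(\<Prod>i\<in>insert u Y. A i (p i)) = 0"
        using i(1) assms(1) by (intro prod_zero) auto
      then show "of_int (sign p) * (\<Prod>i\<in>insert u Y. A i (p i)) = 0" by simp
    qed
  qed
  also have "\<dots> = det_on Y A"
    unfolding det_on_def
  proof (intro sum.cong refl)
    fix p assume "p \<in> {p. p permutes Y}"
    then have "p u = u" using permutes_not_in assms(2) by fastforce
    then show "of_int (sign p) * (\<Prod>i\<in>insert u Y. A i (p i)) = of_int (sign p) * (\<Prod>i\<in>Y. A i (p i))"
      using assms by simp
  qed
  finally show ?thesis .
qed

lemma det_on_singleton [simp]: "det_on {u} A = A u u"
  by (simp add: det_on_def permutes_sing)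

text \<open>Row \<open>u\<close> clears the rest of column \<open>u\<close>. A pivot equal to
  \<open>1\<close> avoids division and suffices later, since a nonzero diagonal entry of a Hermitian
  matrix over \<open>GF(4)\<close> is \<open>1\<close>.\<close>

lemma det_on_schur_complement:
  assumes "finite Y" "u \<notin> Y" "A u u = 1"
  shows "det_on (insert u Y) A = det_on Y (\<lambda>i j. A i j - A i u * A u j)"
proof -
  let ?B = "\<lambda>i j. if i \<in> Y then A i j + (- A i u) * A u j else A i j"
  have "det_on (insert u Y) A = det_on (insert u Y) ?B"
    by (rule det_on_add_row_multiples[symmetric]) (use assms in auto)
  also have "\<dots> = det_on Y ?B"
    by (rule det_on_unit_column) (use assms in auto)
  also have "\<dots> = det_on Y (\<lambda>i j. A i j - A i u * A u j)"
    by (rule det_on_cong) auto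
  finally show ?thesis .
qed

text \<open>The new row \<open>u\<close> is the old one plus a unit vector, so linearity and
  expansion along that unit row give the two minors. Over \<open>GF(2)\<close> the sum becomes the
  parity rule of loop complementation.\<close>

lemma det_on_add_diagonal:
  assumes "finite Y" "u \<notin> Y"
  shows "det_on (insert u Y) (A(u := (A u)(u := A u u + 1))) = det_on (insert u Y) A + det_on Y A"
proof -
  let ?e = "\<lambda>j. if j = u then 1 else 0"
  let ?X = "insert u Y"
  have "(A u)(u := A u u + 1) = (\<lambda>j. A u j + 1 * ?e j)" by auto
  then have "det_on ?X (A(u := (A u)(u := A u u + 1))) = det_on ?X (A(u := A u)) + 1 * det_on ?X (A(u := ?e))"
    using det_on_row_linear[of ?X u A "A u" 1 ?e] assms by simp
  also have "det_on ?X (A(u := ?e)) = det_on ?X (\<lambda>i j. (A(u := ?e)) j i)"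
    by (rule det_on_transpose[symmetric]) (use assms in simp)
  also have "\<dots> = det_on Y (\<lambda>i j. (A(u := ?e)) j i)"
    by (rule det_on_unit_column) (use assms in auto)
  also have "\<dots> = det_on Y (A(u := ?e))"
    by (rule det_on_transpose) (use assms in simp)
  also have "\<dots> = det_on Y A"
    by (rule det_on_cong) (use assms in auto)
  finally show ?thesis by (simp only: mult_1 fun_upd_triv)
qed

section \<open>Hermitian matrices over the field with four elements\<close>

lemma gf4_uminus [simp]: "- x = (x :: gf4)"
  by (cases x) simp

lemma gf4_add_self [simp]: "x + x = (0 :: gf4)"
  using add.right_inverse[of x] by simp

lemma gf4_minus: "x - y = x + (y :: gf4)"
  using diff_conv_add_uminus[of x y] by simp

lemma gf4_inv_0 [simp]: "gf4_inv 0 = 0" and gf4_inv_1 [simp]: "gf4_inv 1 = 1"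
  by (simp_all add: gf4_inv_def)

lemma gf4_inv_add: "gf4_inv (x + y) = gf4_inv x + gf4_inv y"
  by (cases x rule: gf4_cases; cases y rule: gf4_cases) (simp_all add: gf4_inv_def power2_eq_square)

lemma gf4_inv_mult: "gf4_inv (x * y) = gf4_inv x * gf4_inv y"
  by (simp add: gf4_inv_def power_mult_distrib)

lemma gf4_inv_sum: "gf4_inv (sum f S) = (\<Sum>i\<in>S. gf4_inv (f i))"
  by (induction S rule: infinite_finite_induct) (auto simp: gf4_inv_add)

lemma gf4_inv_prod: "gf4_inv (prod f S) = (\<Prod>i\<in>S. gf4_inv (f i))"
  by (induction S rule: infinite_finite_induct) (auto simp: gf4_inv_mult)

lemma gf4_inv_fixed: "gf4_inv x = x \<longleftrightarrow> x = 0 \<or> x = 1"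
  by (cases x rule: gf4_cases)
    (simp_all add: gf4_inv_def power2_eq_square zero_gf4_def one_gf4_def)

lemma gf4_inv_det_on: "gf4_inv (det_on X A) = det_on X (\<lambda>i j. gf4_inv (A i j))"
  unfolding det_on_def gf4_inv_sum gf4_inv_mult gf4_inv_prod
  by (intro sum.cong refl) (simp add: sign_def)

lemma inv_symmetricD:
  assumes "inv_symmetric V A" "i \<in> V" "j \<in> V"
  shows "gf4_inv (A j i) = A i j"
  using assms by (simp add: inv_symmetric_def)

text \<open>Entrywise \<open>gf4_inv\<close> transposes \<open>A\<close> on \<open>X\<close>, so the
  minor is fixed by the automorphism and lies in the prime field.\<close>

lemma det_on_inv_symmetric:
  assumes "finite V" "inv_symmetric V A" "X \<subseteq> V"
  shows "det_on X A = 0 \<or> det_on X A = 1"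
proof -
  have "gf4_inv (det_on X A) = det_on X (\<lambda>i j. A j i)"
    unfolding gf4_inv_det_on by (rule det_on_cong) (use assms(3) inv_symmetricD[OF assms(2)] in auto)
  also have "\<dots> = det_on X A"
    by (rule det_on_transpose) (use assms(1,3) finite_subset in auto)
  finally show ?thesis by (simp add: gf4_inv_fixed)
qed

section \<open>Families of feasible sets\<close>

text \<open>A preimage instead of the image in \<open>twist\<close>: both agree because symmetric
  difference with \<open>X\<close> is an involution, and membership then needs no
  existential.\<close>

definition twist_family :: "'a set \<Rightarrow> 'a set set \<Rightarrow> 'a set set" where
  "twist_family X D = {Y. sym_diff Y X \<in> D}"

text \<open>Inequality of truth values is addition of indicator functions over
  \<open>GF(2)\<close>.\<close>

definition loop_complement_at :: "'a \<Rightarrow> 'a set set \<Rightarrow> 'a set set" where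
  "loop_complement_at u D = {Y. (Y \<in> D) \<noteq> (u \<in> Y \<and> Y - {u} \<in> D)}"

lemma twist_eq_twist_family: "twist (V, D) X = (V, twist_family X D)"
proof -
  have "sym_diff (sym_diff Y X) X = Y" for Y :: "'a set" by auto
  then have "{sym_diff Y X | Y. Y \<in> D} = {Y. sym_diff Y X \<in> D}"
    by (intro set_eqI) (simp only: mem_Collect_eq, metis)
  then show ?thesis by (simp only: twist_def twist_family_def fst_conv snd_conv)
qed

lemma loop_complement_empty:
  assumes "D \<subseteq> Pow V"
  shows "loop_complement (V, D) {} = (V, D)"
proof -
  have "{Z \<in> D. Y - {} \<subseteq> Z \<and> Z \<subseteq> Y} = (if Y \<in> D then {Y} else {})" for Y by auto
  then have "odd (card {Z \<in> D. Y - {} \<subseteq> Z \<and> Z \<subseteq> Y}) \<longleftrightarrow> Y \<in> D" for Y by simp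
  then show ?thesis using assms unfolding loop_complement_def by auto
qed

text \<open>For \<open>u\<close> in \<open>Y\<close>, the sets \<open>Z\<close> counted for
  \<open>insert u X\<close> split into those containing \<open>u\<close>, counted for
  \<open>X\<close> at \<open>Y\<close>, and those omitting \<open>u\<close>, counted for
  \<open>X\<close> at \<open>Y - {u}\<close>.\<close>

lemma loop_complement_insert:
  assumes "finite V" "D \<subseteq> Pow V" "u \<in> V" "u \<notin> X"
  shows "loop_complement (V, D) (insert u X) =
    (V, loop_complement_at u (snd (loop_complement (V, D) X)))"
proof -
  let ?S = "\<lambda>X Y. {Z \<in> D. Y - X \<subseteq> Z \<and> Z \<subseteq> Y}"
  have "finite D" using assms finite_subset by blast
  have odd: "odd (card (?S (insert u X) Y)) \<longleftrightarrow>
      odd (card (?S X Y)) \<noteq> (u \<in> Y \<and> odd (card (?S X (Y - {u}))))" for Y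
  proof (cases "u \<in> Y")
    case True
    have "?S (insert u X) Y = ?S X Y \<union> ?S X (Y - {u})" using True assms(4) by auto
    moreover have "?S X Y \<inter> ?S X (Y - {u}) = {}" using True assms(4) by auto
    ultimately have "card (?S (insert u X) Y) = card (?S X Y) + card (?S X (Y - {u}))"
      using \<open>finite D\<close> by (simp add: card_Un_disjoint)
    then show ?thesis using True by auto
  next
    case False
    then have "?S (insert u X) Y = ?S X Y" by auto
    then show ?thesis using False by simp
  qed
  have sub: "Y - {u} \<subseteq> V \<longleftrightarrow> Y \<subseteq> V" for Y using assms(3) by auto
  show ?thesis
    unfolding loop_complement_def loop_complement_at_def fst_conv snd_conv odd mem_Collect_eq sub
    by blast
qed

lemma twist_family_empty [simp]: "twist_family {} D = D"
  by (simp add: twist_family_def)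

lemma twist_family_twist_family:
  "twist_family X (twist_family Y D) = twist_family (sym_diff X Y) D"
proof -
  have "sym_diff (sym_diff Z X) Y = sym_diff Z (sym_diff X Y)" for Z by auto
  then show ?thesis by (simp add: twist_family_def)
qed

lemma loop_complement_at_twist_family:
  assumes "u \<notin> W"
  shows "loop_complement_at u (twist_family W D) = twist_family W (loop_complement_at u D)"
proof -
  have "sym_diff (Y - {u}) W = sym_diff Y W - {u}" "u \<in> sym_diff Y W \<longleftrightarrow> u \<in> Y" for Y
    using assms by auto
  then show ?thesis by (auto simp: loop_complement_at_def twist_family_def)
qed

lemma mem_twist_family_singleton:
  "Y \<in> twist_family {u} D \<longleftrightarrow> (if u \<in> Y then Y - {u} \<in> D else insert u Y \<in> D)"
proof -
  have "sym_diff Y {u} = (if u \<in> Y then Y - {u} else insert u Y)" by auto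
  then show ?thesis by (simp add: twist_family_def)
qed

lemma mem_loop_complement_at:
  "Y \<in> loop_complement_at u D \<longleftrightarrow> (Y \<in> D) \<noteq> (u \<in> Y \<and> Y - {u} \<in> D)"
  by (simp add: loop_complement_at_def)

text \<open>On the indicator values \<open>(a, b)\<close> of a set without and with
  \<open>u\<close>, the twist gives \<open>(b, a)\<close> and loop complementation
  \<open>(a, a + b)\<close>; both sides yield \<open>(b, a + b)\<close>. On the right, loop
  complementation comes first and can make \<open>{u}\<close> feasible for a pivot.\<close>

lemma loop_complement_twist_braid:
  "loop_complement_at u (twist_family {u} D) =
    twist_family {u} (loop_complement_at u (twist_family {u} (loop_complement_at u D)))"
proof (rule set_eqI)
  fix Y
  have "insert u (Y - {u}) = Y" if "u \<in> Y" using that by auto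
  then show "Y \<in> loop_complement_at u (twist_family {u} D) \<longleftrightarrow>
    Y \<in> twist_family {u} (loop_complement_at u (twist_family {u} (loop_complement_at u D)))"
    by (cases "u \<in> Y") (auto simp: mem_twist_family_singleton mem_loop_complement_at)
qed

lemma loop_complement_twist_braid_twice:
  "loop_complement_at u (twist_family {u} (loop_complement_at u (twist_family {u} (loop_complement_at u D)))) =
    twist_family {u} D"
proof (rule set_eqI)
  fix Y
  have "insert u (Y - {u}) = Y" if "u \<in> Y" using that by auto
  then show "Y \<in> loop_complement_at u (twist_family {u} (loop_complement_at u
      (twist_family {u} (loop_complement_at u D)))) \<longleftrightarrow> Y \<in> twist_family {u} D"
    by (cases "u \<in> Y") (auto simp: mem_twist_family_singleton mem_loop_complement_at)
qed

section \<open>Feasible families of Hermitian matrices\<close>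

definition hermitian_families :: "'a set \<Rightarrow> 'a set set set" where
  "hermitian_families V = {{X. X \<subseteq> V \<and> det_on X A \<noteq> 0} | A. inv_symmetric V A}"

lemma hermitian_familiesI:
  assumes "inv_symmetric V A" "\<And>Y. Y \<in> D \<longleftrightarrow> Y \<subseteq> V \<and> det_on Y A \<noteq> 0"
  shows "D \<in> hermitian_families V"
proof -
  have "D = {X. X \<subseteq> V \<and> det_on X A \<noteq> 0}" using assms(2) by blast
  then show ?thesis using assms(1) by (auto simp: hermitian_families_def)
qed

lemma empty_mem_hermitian_family: "D \<in> hermitian_families V \<Longrightarrow> {} \<in> D"
  by (auto simp: hermitian_families_def det_on_def)

lemma hermitian_family_subset: "D \<in> hermitian_families V \<Longrightarrow> D \<subseteq> Pow V"
  by (auto simp: hermitian_families_def)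

lemma hermitian_families_loop_complement:
  assumes "finite V" "u \<in> V" "D \<in> hermitian_families V"
  shows "loop_complement_at u D \<in> hermitian_families V"
proof -
  from assms(3) obtain A where A: "inv_symmetric V A" and D: "D = {X. X \<subseteq> V \<and> det_on X A \<noteq> 0}"
    by (auto simp: hermitian_families_def)
  let ?B = "A(u := (A u)(u := A u u + 1))"
  have "inv_symmetric V ?B"
    using A assms(2) by (auto simp: inv_symmetric_def gf4_inv_add)
  moreover have "Y \<in> loop_complement_at u D \<longleftrightarrow> Y \<subseteq> V \<and> det_on Y ?B \<noteq> 0" for Y
  proof (cases "u \<in> Y \<and> Y \<subseteq> V")
    case True
    then have fin: "finite (Y - {u})" and ins: "insert u (Y - {u}) = Y" and "Y - {u} \<subseteq> V"
      using assms(1) finite_subset by auto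
    have "det_on Y ?B = det_on Y A + det_on (Y - {u}) A"
      using det_on_add_diagonal[OF fin, of u A] ins by simp
    \<comment> \<open>Both minors are \<open>0\<close> or \<open>1\<close>, so their sum is nonzero
      iff exactly one of them is.\<close>
    then show ?thesis
      using det_on_inv_symmetric[OF assms(1) A, of Y] True \<open>Y - {u} \<subseteq> V\<close>
        det_on_inv_symmetric[OF assms(1) A, of "Y - {u}"]
      by (auto simp: mem_loop_complement_at D)
  next
    case False
    then have "det_on Y ?B = det_on Y A" if "Y \<subseteq> V"
      using that by (intro det_on_cong) auto
    then show ?thesis using False assms(2) by (auto simp: mem_loop_complement_at D)
  qed
  ultimately show ?thesis by (rule hermitian_familiesI)
qed

lemma hermitian_families_pivot:
  assumes "finite V" "D \<in> hermitian_families V" "{u} \<in> D"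
  shows "twist_family {u} D \<in> hermitian_families V"
proof -
  from assms(2) obtain A where A: "inv_symmetric V A" and D: "D = {X. X \<subseteq> V \<and> det_on X A \<noteq> 0}"
    by (auto simp: hermitian_families_def)
  have u: "u \<in> V" using assms(3) D by auto
  have "det_on {u} A \<noteq> 0" using assms(3) D by auto
  then have Auu: "A u u = 1"
    using det_on_inv_symmetric[OF assms(1) A, of "{u}"] u by auto
  \<comment> \<open>Principal pivot transform at \<open>u\<close>: with pivot \<open>1\<close> and
    no signs, row and column \<open>u\<close> stay, and the remaining block is the Schur
    complement.\<close>
  define B where "B = (\<lambda>i j. if i = u \<or> j = u then A i j else A i j + A i u * A u j)"
  have sym: "inv_symmetric V B"
    unfolding inv_symmetric_def B_def
    using u by (auto simp: gf4_inv_add gf4_inv_mult inv_symmetricD[OF A])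
  have schur_A: "det_on (insert u Y) A = det_on Y B" if "u \<notin> Y" "finite Y" for Y
  proof -
    have "det_on (insert u Y) A = det_on Y (\<lambda>i j. A i j - A i u * A u j)"
      using that Auu by (intro det_on_schur_complement) auto
    also have "\<dots> = det_on Y B"
      using that by (intro det_on_cong) (auto simp: B_def gf4_minus)
    finally show ?thesis .
  qed
  \<comment> \<open>In characteristic 2 the pivot is an involution, so the case \<open>u \<in> Y\<close> is again a Schur complement.\<close>
  have schur_B: "det_on (insert u Y) B = det_on Y A" if "u \<notin> Y" "finite Y" for Y
  proof -
    have "det_on (insert u Y) B = det_on Y (\<lambda>i j. B i j - B i u * B u j)"
      using that Auu by (intro det_on_schur_complement) (auto simp: B_def)
    also have "\<dots> = det_on Y A"
      using that by (intro det_on_cong) (auto simp: B_def gf4_minus add.assoc)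
    finally show ?thesis .
  qed
  have "Y \<in> twist_family {u} D \<longleftrightarrow> Y \<subseteq> V \<and> det_on Y B \<noteq> 0" for Y
  proof (cases "Y \<subseteq> V")
    case True
    then have fin: "finite Y" using assms(1) finite_subset by blast
    show ?thesis
    proof (cases "u \<in> Y")
      case True
      then have "det_on Y B = det_on (Y - {u}) A"
        using schur_B[of "Y - {u}"] fin by (simp add: insert_absorb)
      then show ?thesis using True \<open>Y \<subseteq> V\<close> by (auto simp: mem_twist_family_singleton D)
    next
      case False
      then show ?thesis
        using schur_A[of Y] fin u \<open>Y \<subseteq> V\<close> by (simp add: mem_twist_family_singleton D)
    qed
  next
    case False
    then show ?thesis using u by (auto simp: mem_twist_family_singleton D)
  qed
  then show ?thesis by (rule hermitian_familiesI[OF sym])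
qed

lemma det_on_pair:
  assumes "u \<noteq> v" "A u u = 0"
  shows "det_on {u, v} A = - (A u v * A v u)"
proof -
  let ?t = "transpose u v"
  have "{p. p permutes {u, v}} = {id, ?t}"
    using assms(1) by (auto simp: permutes_doubleton_iff)
  moreover have "id \<noteq> ?t"
    using assms(1) by (metis id_apply transpose_apply_first)
  ultimately show ?thesis
    using assms by (simp add: det_on_def sign_swap_id)
qed

text \<open>The exchange axiom at the empty set: row \<open>u\<close> of the nonsingular
  \<open>A[X]\<close> has a nonzero entry, on the diagonal or at some \<open>v\<close>, where
  symmetry makes both off-diagonal entries nonzero.\<close>

lemma hermitian_family_exchange:
  assumes "finite V" "D \<in> hermitian_families V" "X \<in> D" "u \<in> X"
  shows "\<exists>v\<in>X. {u, v} \<in> D"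
proof -
  from assms(2) obtain A where A: "inv_symmetric V A" and D: "D = {X. X \<subseteq> V \<and> det_on X A \<noteq> 0}"
    by (auto simp: hermitian_families_def)
  have X: "X \<subseteq> V" "det_on X A \<noteq> 0" "finite X" using assms D finite_subset by auto
  show ?thesis
  proof (cases "A u u = 0")
    case False
    then have "{u, u} \<in> D" using X assms(4) by (auto simp: D)
    then show ?thesis using assms(4) by blast
  next
    case True
    obtain v where v: "v \<in> X" "A u v \<noteq> 0"
      using det_on_zero_row[of X u A] X assms(4) by blast
    then have "A v u \<noteq> 0"
      using inv_symmetricD[OF A, of u v] X(1) assms(4) by (metis gf4_inv_0 subsetD)
    moreover have "u \<noteq> v" using v True by auto
    ultimately have "{u, v} \<in> D"
      using v True X assms(4) by (auto simp: D det_on_pair)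
    then show ?thesis using v by blast
  qed
qed

text \<open>Neither single twist is a pivot in \<open>D\<close>. The twist at \<open>u\<close> is
  therefore expanded into loop complementations and twists at \<open>u\<close>, and the twist at
  \<open>v\<close> is inserted where \<open>{v}\<close> has become feasible.\<close>

lemma hermitian_families_pivot_pair:
  assumes "finite V" "D \<in> hermitian_families V"
    and "u \<noteq> v" "{u, v} \<in> D" "{u} \<notin> D" "{v} \<notin> D"
  shows "twist_family {u, v} D \<in> hermitian_families V"
proof -
  have uv: "u \<in> V" "v \<in> V" using hermitian_family_subset[OF assms(2)] assms(4) by auto
  have "{} \<in> D" using empty_mem_hermitian_family[OF assms(2)] .
  note mem = mem_twist_family_singleton mem_loop_complement_at
  note lc = hermitian_families_loop_complement[OF assms(1) uv(1)]
  note piv = hermitian_families_pivot[OF assms(1)]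
  have diff: "{u, v} - {u} = {v}" "{u, v} - {v} = {u}" using assms(3) by auto
  define D1 where "D1 = loop_complement_at u D"
  define D2 where "D2 = twist_family {u} D1"
  define D3 where "D3 = loop_complement_at u D2"
  define D4 where "D4 = twist_family {v} D3"
  define D5 where "D5 = twist_family {u} D4"
  \<comment> \<open>These memberships are tracked to license the pivots at \<open>u\<close> in
    \<open>D1\<close>, at \<open>v\<close> in \<open>D3\<close> and at \<open>u\<close> in
    \<open>D4\<close>.\<close>
  have D1: "{u} \<in> D1" "{u, v} \<in> D1" "{v} \<notin> D1"
    using assms \<open>{} \<in> D\<close> diff by (auto simp: D1_def mem)
  have D2: "{v} \<in> D2" "{u, v} \<notin> D2"
    using D1 diff assms(3) by (auto simp: D2_def mem)
  have D3: "{v} \<in> D3" "{u, v} \<in> D3"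
    using D2 diff assms(3) by (auto simp: D3_def mem)
  have D4: "{u} \<in> D4"
    using D3 assms(3) by (auto simp: D4_def mem insert_commute)
  have "loop_complement_at u D5 \<in> hermitian_families V"
    unfolding D5_def D4_def D3_def D2_def D1_def
    by (intro lc piv assms(2)) (use D1 D3 D4 in \<open>simp_all add: D4_def D3_def D2_def D1_def\<close>)
  moreover have "D5 = twist_family {v} (twist_family {u} D3)"
    by (simp add: D5_def D4_def twist_family_twist_family Un_commute)
  then have "loop_complement_at u D5 = twist_family {v} (twist_family {u} D)"
    using assms(3) by (simp add: loop_complement_at_twist_family D3_def D2_def D1_def
        loop_complement_twist_braid_twice)
  then have "loop_complement_at u D5 = twist_family {u, v} D"
    using assms(3) by (simp add: twist_family_twist_family insert_Diff_if insert_commute)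
  ultimately show ?thesis by simp
qed

text \<open>Induction on the size of \<open>X\<close>: a feasible singleton or pair \<open>W\<close>
  inside \<open>X\<close> is pivoted away, after which \<open>X - W\<close> is feasible in the
  twisted family.\<close>

lemma hermitian_families_twist_feasible:
  assumes "finite V" "D \<in> hermitian_families V" "X \<in> D"
  shows "twist_family X D \<in> hermitian_families V"
  using assms(2,3)
proof (induction "card X" arbitrary: X D rule: less_induct)
  case less
  have X: "finite X" using hermitian_family_subset[OF less(2)] less(3) assms(1) finite_subset by blast
  have step: ?case
    if "W \<subseteq> X" "W \<noteq> {}" "twist_family W D \<in> hermitian_families V" for W
  proof -
    have sd: "sym_diff (X - W) W = X" using that by auto
    have "X - W \<in> twist_family W D" using less(3) sd by (simp add: twist_family_def)
    moreover have "card (X - W) < card X" using that X by (intro psubset_card_mono) auto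
    ultimately have "twist_family (X - W) (twist_family W D) \<in> hermitian_families V"
      using less(1) that(3) by blast
    then show ?thesis by (simp only: twist_family_twist_family sd)
  qed
  consider "X = {}" | u where "u \<in> X" "{u} \<in> D" | "X \<noteq> {}" "\<And>u. u \<in> X \<Longrightarrow> {u} \<notin> D" by blast
  then show ?case
  proof cases
    case 1
    then show ?thesis using less(2) by simp
  next
    case (2 u)
    then show ?thesis using step[of "{u}"] hermitian_families_pivot[OF assms(1) less(2)] by blast
  next
    case 3
    then obtain u where u: "u \<in> X" by blast
    then obtain v where v: "v \<in> X" "{u, v} \<in> D"
      using hermitian_family_exchange[OF assms(1) less(2,3)] by blast
    then have "u \<noteq> v" using 3(2)[OF u] by auto
    then have "twist_family {u, v} D \<in> hermitian_families V"
      using hermitian_families_pivot_pair[OF assms(1) less(2)] v 3(2) u by blast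
    then show ?thesis using step[of "{u, v}"] u v by blast
  qed
qed

section \<open>Twists of Hermitian families\<close>

definition twisted_hermitian_families :: "'a set \<Rightarrow> 'a set set set" where
  "twisted_hermitian_families V = {twist_family W D | W D. W \<subseteq> V \<and> D \<in> hermitian_families V}"

lemma inv_representable_iff: "inv_representable (V, D) \<longleftrightarrow> D \<in> twisted_hermitian_families V"
  unfolding inv_representable_def twisted_hermitian_families_def hermitian_families_def
    matrix_set_system_def
  by (auto simp: twist_eq_twist_family)

lemma twisted_hermitian_families_twist:
  assumes "D \<in> twisted_hermitian_families V" "X \<subseteq> V"
  shows "twist_family X D \<in> twisted_hermitian_families V"
proof -
  from assms(1) obtain W E where "W \<subseteq> V" "E \<in> hermitian_families V" "D = twist_family W E"
    by (auto simp: twisted_hermitian_families_def)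
  moreover have "sym_diff X W \<subseteq> V" using \<open>W \<subseteq> V\<close> assms(2) by auto
  ultimately show ?thesis
    unfolding twisted_hermitian_families_def using twist_family_twist_family by blast
qed

lemma twisted_hermitian_familiesI:
  assumes "D \<in> hermitian_families V"
  shows "D \<in> twisted_hermitian_families V"
proof -
  have "D = twist_family {} D \<and> {} \<subseteq> V \<and> D \<in> hermitian_families V" using assms by simp
  then show ?thesis unfolding twisted_hermitian_families_def by blast
qed

text \<open>Only the part of the twist at \<open>u\<close> interferes, the rest commutes. If that
  part is not a pivot, the braid relation trades it for a pivot after loop complementation and an
  outer twist.\<close>

lemma twisted_hermitian_families_loop_complement:
  assumes "finite V" "u \<in> V" "D \<in> twisted_hermitian_families V"
  shows "loop_complement_at u D \<in> twisted_hermitian_families V"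
proof -
  from assms(3) obtain W E where W: "W \<subseteq> V" and E: "E \<in> hermitian_families V"
    and D: "D = twist_family W E"
    by (auto simp: twisted_hermitian_families_def)
  note lc = hermitian_families_loop_complement[OF assms(1,2)]
  note piv = hermitian_families_pivot[OF assms(1)]
  show ?thesis
  proof (cases "u \<in> W")
    case False
    then have "loop_complement_at u D = twist_family W (loop_complement_at u E)"
      by (simp add: D loop_complement_at_twist_family)
    then show ?thesis
      using twisted_hermitian_families_twist[OF twisted_hermitian_familiesI[OF lc[OF E]] W] by simp
  next
    case True
    have "loop_complement_at u (twist_family {u} E) \<in> twisted_hermitian_families V"
    proof (cases "{u} \<in> E")
      case True
      then show ?thesis by (intro twisted_hermitian_familiesI lc piv E)
    next
      case False
      \<comment> \<open>The empty set is feasible in \<open>E\<close> and \<open>{u}\<close> is not,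
        so the parity at \<open>{u}\<close> is odd.\<close>
      then have "{u} \<in> loop_complement_at u E"
        using empty_mem_hermitian_family[OF E] by (simp add: mem_loop_complement_at)
      then have "loop_complement_at u (twist_family {u} (loop_complement_at u E)) \<in> hermitian_families V"
        by (intro lc piv E)
      then show ?thesis
        unfolding loop_complement_twist_braid[of u E] using assms(2)
        by (intro twisted_hermitian_families_twist twisted_hermitian_familiesI) auto
    qed
    moreover have "sym_diff (W - {u}) {u} = W" using True by auto
    then have "D = twist_family (W - {u}) (twist_family {u} E)"
      by (simp only: D twist_family_twist_family)
    then have "loop_complement_at u D =
        twist_family (W - {u}) (loop_complement_at u (twist_family {u} E))"
      by (simp add: loop_complement_at_twist_family)
    moreover have "W - {u} \<subseteq> V" using W by auto
    ultimately show ?thesis by (simp only: twisted_hermitian_families_twist)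
  qed
qed

text \<open>Twisting by a feasible \<open>X\<close> moves it to the empty set and leaves a Hermitian
  family, so exchange at \<open>X\<close> follows from \<open>hermitian_family_exchange\<close>
  applied to \<open>sym_diff X Y\<close>.\<close>

lemma delta_matroid_twisted_hermitian_family:
  assumes "finite V" "D \<in> twisted_hermitian_families V"
  shows "delta_matroid (V, D)"
proof -
  from assms(2) obtain W E where W: "W \<subseteq> V" and E: "E \<in> hermitian_families V"
    and D: "D = twist_family W E"
    by (auto simp: twisted_hermitian_families_def)
  have subset: "D \<subseteq> Pow V"
  proof
    fix Y assume "Y \<in> D"
    then have "sym_diff Y W \<in> E" unfolding D twist_family_def mem_Collect_eq .
    then have "sym_diff Y W \<subseteq> V" using hermitian_family_subset[OF E] by (metis PowD subsetD)
    then show "Y \<in> Pow V" using W by blast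
  qed
  have "W \<in> D" using empty_mem_hermitian_family[OF E] by (simp add: D twist_family_def)
  then have "D \<noteq> {}" by blast
  moreover have "\<exists>y\<in>sym_diff X Y. sym_diff X {x, y} \<in> D"
    if "X \<in> D" "Y \<in> D" "x \<in> sym_diff X Y" for X Y x
  proof -
    have "sym_diff X W \<in> E" using that(1) by (simp add: D twist_family_def)
    then have F: "twist_family X D \<in> hermitian_families V"
      unfolding D twist_family_twist_family
      by (rule hermitian_families_twist_feasible[OF assms(1) E])
    have "sym_diff (sym_diff X Y) X = Y" by auto
    then have "sym_diff X Y \<in> twist_family X D" using that(2) by (simp add: twist_family_def)
    from hermitian_family_exchange[OF assms(1) F this that(3)]
    obtain y where "y \<in> sym_diff X Y" "{x, y} \<in> twist_family X D" by blast
    then show ?thesis by (auto simp: twist_family_def Un_commute)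
  qed
  ultimately show ?thesis
    using assms(1) subset unfolding delta_matroid_def set_system_def proper_def by auto
qed

text \<open>Over a finite ground set the exchange axiom is automatic, so closure need only be
  checked for representability.\<close>

lemma mem_inv_representable_delta_matroids_iff:
  "(V, D) \<in> inv_representable_delta_matroids \<longleftrightarrow> finite V \<and> D \<in> twisted_hermitian_families V"
proof -
  have "finite V" if "delta_matroid (V, D)"
    using that by (simp add: delta_matroid_def set_system_def)
  then show ?thesis
    unfolding inv_representable_delta_matroids_def mem_Collect_eq inv_representable_iff
    using delta_matroid_twisted_hermitian_family by metis
qed

theorem theorem2:
  fixes V :: "'a set" and D :: "'a set set" and X :: "'a set"
  assumes "(V, D) \<in> inv_representable_delta_matroids"
    and "X \<subseteq> V"
  shows "twist (V, D) X \<in> inv_representable_delta_matroids \<and>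
         loop_complement (V, D) X \<in> inv_representable_delta_matroids"
proof
  have V: "finite V" and D: "D \<in> twisted_hermitian_families V"
    using assms(1) by (auto simp: mem_inv_representable_delta_matroids_iff)
  have "D \<subseteq> Pow V"
    using delta_matroid_twisted_hermitian_family[OF V D] by (simp add: delta_matroid_def set_system_def)
  show "twist (V, D) X \<in> inv_representable_delta_matroids"
    using twisted_hermitian_families_twist[OF D assms(2)] V
    by (simp add: twist_eq_twist_family mem_inv_representable_delta_matroids_iff)
  have "finite X" using V assms(2) finite_subset by blast
  then show "loop_complement (V, D) X \<in> inv_representable_delta_matroids"
    using assms(2)
  proof (induction X)
    case empty
    show ?case using loop_complement_empty[OF \<open>D \<subseteq> Pow V\<close>] assms(1) by simp
  next
    case (insert u X)
    \<comment> \<open>Loop complementation keeps the ground set; the pair form lets the induction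
      hypothesis be read as a statement about families over \<open>V\<close>.\<close>
    have "loop_complement (V, D) X = (V, snd (loop_complement (V, D) X))"
      by (simp add: loop_complement_def)
    then have "snd (loop_complement (V, D) X) \<in> twisted_hermitian_families V"
      using insert mem_inv_representable_delta_matroids_iff by (metis insert_subset)
    then show ?case
      using insert loop_complement_insert[OF V \<open>D \<subseteq> Pow V\<close>, of u X] V
        twisted_hermitian_families_loop_complement[OF V, of u]
      by (simp add: mem_inv_representable_delta_matroids_iff)
  qed
qed

end
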